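(* Let $f,g\in\mathbb{K}[x]$ be polynomials of degrees $m$ and $n$, respectively, and define $\tilde f=f(y)\cdot(y-x)\in\mathbb{K}(x)[y]$ and $\tilde g=g(y)\cdot(y-x)\in\mathbb{K}(x)[y]$. Then for any $0\le d<\min\{m,n\}$, $$F_d(f,g)(x)=(-1)^{m-d}\operatorname{coeff}_{y^{d+1}}\big(\operatorname{Sres}_{d+1}(\tilde f,g(y))\big),$$ $$G_d(f,g)(x)=\operatorname{coeff}_{y^{d+1}}\big(\operatorname{Sres}_{d+1}(f(y),\tilde g)\big).$$
   Context: $\mathbb{K}$ is a field; $x,y$ are indeterminates; $\operatorname{coeff}_{y^{k}}(p)$ is the coefficient of $y^k$ in $p\in\mathbb{K}(x)[y]$. Subresultant: for polynomials $p=p_\mu y^\mu+\cdots+p_0$ and $q=q_\nu y^\nu+\cdots+q_0$ of degrees $\mu,\nu$ in $y$ over a field, and $0\le e\le\min\{\mu,\nu\}$ if $\mu\ne\nu$ or $0\le e<\mu=\nu$, $\operatorname{Sres}_e(p,q)$ (a polynomial in $y$) is the determinant of the following square matrix of size $\mu+\nu-2e$ (coefficients with index outside the range are $0$): for $1\le i\le\nu-e$, row $i$ has entry $p_{\mu+i-j}$ in column $j$ for $1\le j\le\mu+\nu-2e-1$ and entry $y^{\nu-e-i}p(y)$ in the last column; for $1\le i\le\mu-e$, row $\nu-e+i$ has entry $q_{\nu+i-j}$ in column $j$ for $1\le j\le\mu+\nu-2e-1$ and entry $y^{\mu-e-i}q(y)$ in the last column. (In $\operatorname{Sres}_{d+1}(\tilde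 f,g(y))$ the degrees are $\mu=m+1,\nu=n$; in $\operatorname{Sres}_{d+1}(f(y),\tilde g)$ they are $\mu=m,\nu=n+1$.) For $f=f_mx^m+\cdots+f_0$, $g=g_nx^n+\cdots+g_0$ and $0\le d<\min\{m,n\}$, $F_d(f,g)(x)$ and $G_d(f,g)(x)$ are determinants of square matrices of size $m+n-2d$. In both matrices, for $1\le j\le m+n-2d-1$, column $j$ has entry $f_{m+i-j}$ in row $i$ for $1\le i\le n-d$, and entry $g_{n+i-j}$ in row $n-d+i$ for $1\le i\le m-d$. The last column is, for $F_d$: entry $x^{n-d-i}$ in row $i$ for $1\le i\le n-d$, and $0$ in the remaining $m-d$ rows; for $G_d$: entry $0$ in the first $n-d$ rows, and $x^{m-d-i}$ in row $n-d+i$ for $1\le i\le m-d$. *)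

theory Defs
  imports Subresultants.Subresultant
begin

text \<open>
  The library's \<^const>\<open>subresultant_mat\<close> lists the shifted coefficients of the two polynomials
  columnwise. The subresultant is usually given by the transposed matrix, with
  rows of coefficients and the polynomials \<open>y^k p\<close>, \<open>y^k q\<close> in the last column.
\<close>

lemma subresultant_rowwise:
  fixes p q :: "'a :: comm_ring_1 poly"
  defines "\<mu> \<equiv> degree p" and "\<nu> \<equiv> degree q"
  assumes "e \<le> min \<mu> \<nu>"
  shows "subresultant e p q =
    (let N = \<mu> + \<nu> - 2 * e
     in det (mat N N (\<lambda>(i, j).
       if i < \<nu> - e then
         if j = N - 1 then monom 1 (\<nu> - e - 1 - i) * p
         else [: coeff_int p (int \<mu> + int i - int j) :]
       else
         let k = i - (\<nu> - e)
         in if j = N - 1 then monom 1 (\<mu> - e - 1 - k) * q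
            else [: coeff_int q (int \<nu> + int k - int j) :])))"
proof -
  define N where "N = \<mu> + \<nu> - 2 * e"
  define R where "R = (\<lambda>(i, j).
       if i < \<nu> - e then
         if j = N - 1 then monom 1 (\<nu> - e - 1 - i) * p
         else [: coeff_int p (int \<mu> + int i - int j) :]
       else
         let k = i - (\<nu> - e)
         in if j = N - 1 then monom 1 (\<mu> - e - 1 - k) * q
            else [: coeff_int q (int \<nu> + int k - int j) :])"
  have N: "(degree p - e) + (degree q - e) = N"
    using assms by (simp add: N_def)
  have comm: "int a - int c + int b = int a + int b - int c" for a b c
    by simp
  have "subresultant_mat e p q = mat N N (\<lambda>(i, j). R (j, i))"
    unfolding subresultant_mat_def Let_def N R_def \<mu>_def \<nu>_def split comm ..
  also have "\<dots> = transpose_mat (mat N N R)"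
    by (rule eq_matI) simp_all
  finally have "subresultant e p q = det (transpose_mat (mat N N R))"
    unfolding subresultant_def by (rule arg_cong)
  also have "\<dots> = det (mat N N R)"
    by (rule det_transpose[of _ N]) simp
  finally show ?thesis
    unfolding R_def N_def Let_def .
qed

text \<open>
  The matrices are indexed from 0. As \<open>coeff_int\<close> takes an integer index, coefficients at negative
  indices or at indices above the degree are 0. The definitions are meant for
  \<open>d < min (degree f) (degree g)\<close>.
\<close>

definition F_mat :: "nat \<Rightarrow> 'a :: field poly \<Rightarrow> 'a poly \<Rightarrow> 'a poly mat" where
  "F_mat d f g =
    (let m = degree f; n = degree g; N = m + n - 2 * d
     in mat N N (\<lambda>(i, j).
       if i < n - d then
         if j = N - 1 then monom 1 (n - d - 1 - i)
         else [: coeff_int f (int m + int i - int j) :]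
       else
         let k = i - (n - d)
         in if j = N - 1 then 0
            else [: coeff_int g (int n + int k - int j) :]))"

definition G_mat :: "nat \<Rightarrow> 'a :: field poly \<Rightarrow> 'a poly \<Rightarrow> 'a poly mat" where
  "G_mat d f g =
    (let m = degree f; n = degree g; N = m + n - 2 * d
     in mat N N (\<lambda>(i, j).
       if i < n - d then
         if j = N - 1 then 0
         else [: coeff_int f (int m + int i - int j) :]
       else
         let k = i - (n - d)
         in if j = N - 1 then monom 1 (m - d - 1 - k)
            else [: coeff_int g (int n + int k - int j) :]))"

definition F_poly :: "nat \<Rightarrow> 'a :: field poly \<Rightarrow> 'a poly \<Rightarrow> 'a poly" where
  "F_poly d f g = det (F_mat d f g)"

definition G_poly :: "nat \<Rightarrow> 'a :: field poly \<Rightarrow> 'a poly \<Rightarrow> 'a poly" where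
  "G_poly d f g = det (G_mat d f g)"

text \<open>
  The rational function field \<open>K(x)\<close> is the type \<open>'a poly fract\<close> and \<open>K(x)[y]\<close> is the type
  \<open>'a poly fract poly\<close>. The polynomial \<open>f(y)\<close> has the coefficients of \<open>f\<close>, embedded as constants
  of \<open>K(x)\<close>.
\<close>

definition in_y :: "'a :: field poly \<Rightarrow> 'a poly fract poly" where
  "in_y f = map_poly (\<lambda>c. to_fract [:c:]) f"

definition x_elem :: "'a :: field poly fract" where
  "x_elem = to_fract [:0, 1:]"

definition tilde :: "'a :: field poly \<Rightarrow> 'a poly fract poly" where
  "tilde f = in_y f * [:- x_elem, 1:]"

end

theory Submission
  imports Defs
begin

text \<open>
  The \<open>k\<close>-th coefficient of \<open>f(y) (y - x)\<close> is \<open>f\<^sub>k\<^sub>-\<^sub>1 - x f\<^sub>k\<close>. In the shifted rows of \<open>F_mat\<close>, the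
  row after a row of coefficients of \<open>f\<close> carries the same coefficients with index raised by one. So
  subtracting \<open>x\<close> times the next row turns a row of \<open>f\<close> into a row of \<open>tilde f\<close>, as
  long as the next row belongs to \<open>f\<close> too. The same step turns the last
  column \<open>x\<^sup>k, ..., x, 1\<close> of these rows into \<open>0, ..., 0, 1\<close>. Expansion along the last column then
  deletes that column and the last row of \<open>f\<close>, and leaves a matrix of scalars: one row of \<open>tilde f\<close>
  fewer than there were of \<open>f\<close>, and all rows of \<open>g\<close>. That step is \<open>det_geometric_last_col\<close>; it
  applies to \<open>G_mat\<close> as well, where the rows of \<open>g\<close> are the ones combined.

  On the other side, taking the coefficient of \<open>y\<^sup>e\<close> of \<open>Sres\<^sub>e\<close> only affects the last column, and
  there the entry of \<open>y\<^sup>k p\<close> continues the index pattern of its row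
  (\<open>coeff_subresultant_index\<close>). For \<open>e = d + 1\<close> this is exactly the matrix
  obtained above. The sign is that of the expansion, decided by the number of rows below the
  deleted one: \<open>m - d\<close> for \<open>F\<close>, none for \<open>G\<close>.
\<close>

section \<open>Determinants with a geometric last column\<close>

text \<open>
  Treating the rows from top to bottom makes each step an elementary row operation with a row
  that is still unchanged.
\<close>

lemma det_subtract_next_rows:
  fixes A :: "'a :: comm_ring_1 mat"
  assumes A: "A \<in> carrier_mat N N" and "b < N"
  shows "det (mat N N (\<lambda>(i, j).
           if a \<le> i \<and> i < b then A $$ (i, j) - c * A $$ (Suc i, j) else A $$ (i, j))) = det A"
    (is "det (?M b) = _")
  using \<open>b < N\<close>
proof (induction b)
  case 0
  have "?M 0 = A"
    using A by (intro eq_matI) auto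
  then show ?case by simp
next
  case (Suc b)
  show ?case
  proof (cases "a \<le> b")
    case True
    then have "?M (Suc b) = addrow (- c) b (Suc b) (?M b)"
      using Suc.prems by (intro eq_matI) (auto simp: less_Suc_eq)
    then show ?thesis
      using Suc by (simp add: det_addrow[of _ N])
  next
    case False
    then have "?M (Suc b) = ?M b"
      by (intro eq_matI) auto
    then show ?thesis
      using Suc by simp
  qed
qed

text \<open>
  Row \<open>b\<close> is the only one whose last entry survives the subtractions, because
  \<open>c\<^sup>k - c c\<^sup>k\<^sup>-\<^sup>1 = 0\<close>; row \<open>b\<close> has no successor among the combined rows and keeps its entry
  \<open>c\<^sup>0 = 1\<close>.
\<close>

lemma det_geometric_last_col:
  fixes A :: "'a :: comm_ring_1 mat"
  assumes A: "A \<in> carrier_mat (Suc N) (Suc N)" and "a \<le> b" and "b \<le> N"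
    and col: "\<And>i. i \<le> N \<Longrightarrow> A $$ (i, N) = (if a \<le> i \<and> i \<le> b then c ^ (b - i) else 0)"
  shows "det A = (-1) ^ (b + N) * det (mat N N (\<lambda>(i, j).
           if a \<le> i \<and> i < b then A $$ (i, j) - c * A $$ (Suc i, j)
           else A $$ (if i < b then i else Suc i, j)))"
proof -
  define B where "B = mat (Suc N) (Suc N) (\<lambda>(i, j).
           if a \<le> i \<and> i < b then A $$ (i, j) - c * A $$ (Suc i, j) else A $$ (i, j))"
  have B: "B \<in> carrier_mat (Suc N) (Suc N)"
    by (simp add: B_def)
  have last_col: "B $$ (i, N) = (if i = b then 1 else 0)" if "i \<le> N" for i
  proof (cases "a \<le> i \<and> i < b")
    case True
    then have "c ^ (b - i) = c * c ^ (b - Suc i)"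
      by (simp add: Suc_diff_Suc flip: power_Suc)
    with True show ?thesis
      using that \<open>b \<le> N\<close> by (simp add: B_def col)
  next
    case False
    then show ?thesis
      using that \<open>a \<le> b\<close> by (auto simp: B_def col)
  qed
  have "det B = (\<Sum>i<Suc N. B $$ (i, N) * cofactor B i N)"
    using B by (rule laplace_expansion_column) simp
  also have "\<dots> = (\<Sum>i<Suc N. if i = b then cofactor B i N else 0)"
    by (rule sum.cong) (auto simp: last_col)
  also have "\<dots> = (-1) ^ (b + N) * det (mat_delete B b N)"
    using \<open>b \<le> N\<close> by (simp add: cofactor_def del: sum.lessThan_Suc)
  also have "mat_delete B b N = mat N N (\<lambda>(i, j).
           if a \<le> i \<and> i < b then A $$ (i, j) - c * A $$ (Suc i, j)
           else A $$ (if i < b then i else Suc i, j))"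
    using B \<open>b \<le> N\<close> by (intro eq_matI) (auto simp: mat_delete_def B_def)
  finally have "det B = (-1) ^ (b + N) * det (mat N N (\<lambda>(i, j).
           if a \<le> i \<and> i < b then A $$ (i, j) - c * A $$ (Suc i, j)
           else A $$ (if i < b then i else Suc i, j)))" .
  moreover have "det B = det A"
    unfolding B_def using A \<open>b \<le> N\<close> by (intro det_subtract_next_rows) auto
  ultimately show ?thesis
    by simp
qed

section \<open>The coefficient of index \<open>e\<close> of the \<open>e\<close>-th subresultant\<close>

text \<open>
  The coefficient of \<open>y\<^sup>e\<close> in \<open>y\<^sup>\<nu>\<^sup>-\<^sup>e\<^sup>-\<^sup>1\<^sup>-\<^sup>i p\<close> has index \<open>2 e + 1 - \<nu> + i = \<mu> + i - (N - 1)\<close>, so the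
  last column follows the same index pattern as the others. The assumption \<open>0 < N\<close> excludes
  \<open>\<mu> = \<nu> = e\<close>, where the determinant is empty and the subresultant is the constant \<open>1\<close>.
\<close>

lemma coeff_subresultant_index:
  fixes p q :: "'a :: comm_ring_1 poly"
  assumes "degree p = \<mu>" and "degree q = \<nu>" and "e \<le> \<mu>" and "e \<le> \<nu>" and "\<mu> + \<nu> = 2 * e + N" and "0 < N"
  shows "coeff (subresultant e p q) e = det (mat N N (\<lambda>(i, j).
           if i < \<nu> - e then coeff_int p (int \<mu> + int i - int j)
           else coeff_int q (int \<nu> + int (i - (\<nu> - e)) - int j)))"
    (is "_ = det ?M")
proof -
  have N: "\<mu> - e + (\<nu> - e) = N"
    using assms by simp
  have M: "?M \<in> carrier_mat N N"
    by simp
  have "subresultant'_mat e e p q = transpose_mat ?M"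
    unfolding subresultant'_mat_def Let_def assms(1,2) N
  proof (rule eq_matI, goal_cases)
    case (1 i j)
    then have ij: "i < N" "j < N"
      by simp_all
    show ?case
    proof (cases "j < \<nu> - e")
      case True
      then show ?thesis
        using ij assms by (auto intro!: arg_cong[of _ _ "coeff_int p"])
    next
      case False
      then show ?thesis
        using ij assms by (auto intro!: arg_cong[of _ _ "coeff_int q"])
    qed
  qed auto
  then show ?thesis
    using assms det_transpose[OF M] by (simp add: coeff_subresultant N)
qed

section \<open>Comparison of the two kinds of matrices\<close>

lemma degree_in_y [simp]: "degree (in_y f) = degree f"
  unfolding in_y_def by (rule degree_map_poly) auto

lemma coeff_int_in_y: "coeff_int (in_y f) k = to_fract [:coeff_int f k:]"
  by (simp add: in_y_def coeff_int_def coeff_map_poly)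

lemma degree_tilde: "f \<noteq> 0 \<Longrightarrow> degree (tilde f) = Suc (degree f)"
proof -
  assume "f \<noteq> 0"
  then have "in_y f \<noteq> 0"
    by (auto simp: in_y_def map_poly_eq_0_iff)
  then show ?thesis
    unfolding tilde_def by (subst degree_mult_eq) auto
qed

lemma coeff_int_tilde:
  "coeff_int (tilde f) k =
    to_fract [:coeff_int f (k - 1):] - x_elem * to_fract [:coeff_int f k:]"
proof -
  have "tilde f = pCons 0 (in_y f) - smult x_elem (in_y f)"
    by (simp add: tilde_def)
  then show ?thesis
    by (simp add: coeff_int_in_y)
qed

lemma to_fract_monom: "to_fract (monom 1 k) = x_elem ^ k"
  by (simp add: x_elem_def monom_altdef flip: to_fract_hom.hom_power)

text \<open>
  The combined rows are those of \<open>f\<close>, from row \<open>0\<close> to row \<open>b = n - d - 1\<close>. The surviving entry has the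
  \<open>m - d\<close> rows of \<open>g\<close> below it, hence the sign.
\<close>

lemma to_fract_F_poly:
  assumes m: "degree f = m" and n: "degree g = n" and "d < m" and "d < n"
  shows "to_fract (F_poly d f g) =
    (-1) ^ (m - d) * coeff (subresultant (d + 1) (tilde f) (in_y g)) (d + 1)"
proof -
  define N where "N = m + n - 2 * d - 1"
  define b where "b = n - d - 1"
  have N: "m + n - 2 * d = Suc N" "m + n = 2 * d + N + 1" "0 < N" and b: "n - d = Suc b" "n - (d + 1) = b" "b \<le> N"
    using assms by (auto simp: N_def b_def)
  define A where "A = map_mat to_fract (F_mat d f g)"
  have A: "A \<in> carrier_mat (Suc N) (Suc N)"
    by (simp add: A_def F_mat_def Let_def m n N)
  have idx: "A $$ (i, j) =
      (if i \<le> b then if j = N then x_elem ^ (b - i)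
         else to_fract [:coeff_int f (int m + int i - int j):]
       else if j = N then 0
         else to_fract [:coeff_int g (int n + int (i - Suc b) - int j):])"
    if "i \<le> N" "j \<le> N" for i j
    using that by (simp add: A_def F_mat_def Let_def m n N b to_fract_monom)
  have "to_fract (F_poly d f g) = det A"
    by (simp add: A_def F_poly_def)
  also have "\<dots> = (-1) ^ (b + N) * det (mat N N (\<lambda>(i, j).
           if 0 \<le> i \<and> i < b then A $$ (i, j) - x_elem * A $$ (Suc i, j)
           else A $$ (if i < b then i else Suc i, j)))"
    by (rule det_geometric_last_col) (use A b in \<open>auto simp: idx\<close>)
  also have "mat N N (\<lambda>(i, j).
           if 0 \<le> i \<and> i < b then A $$ (i, j) - x_elem * A $$ (Suc i, j)
           else A $$ (if i < b then i else Suc i, j)) =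
         mat N N (\<lambda>(i, j).
           if i < n - (d + 1) then coeff_int (tilde f) (int (Suc m) + int i - int j)
           else coeff_int (in_y g) (int n + int (i - (n - (d + 1))) - int j))"
    using b by (intro eq_matI) (auto simp: idx coeff_int_tilde coeff_int_in_y algebra_simps)
  also have "det \<dots> = coeff (subresultant (d + 1) (tilde f) (in_y g)) (d + 1)"
    using assms N by (intro coeff_subresultant_index[symmetric]) (auto intro!: degree_tilde)
  also have "(-1) ^ (b + N) = ((-1) ^ (m - d) :: 'a poly fract)"
  proof -
    have "b + N = (m - d) + 2 * b"
      using assms by (auto simp: b_def N_def)
    then show ?thesis
      by (simp add: power_add)
  qed
  finally show ?thesis .
qed

text \<open>
  Here the combined rows are those of \<open>g\<close>, from \<open>a = n - d\<close> down to the last row \<open>N\<close>. The entry that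
  survives is in the bottom right corner, so the expansion has the sign \<open>+\<close>.
\<close>

lemma to_fract_G_poly:
  assumes m: "degree f = m" and n: "degree g = n" and "d < m" and "d < n"
  shows "to_fract (G_poly d f g) = coeff (subresultant (d + 1) (in_y f) (tilde g)) (d + 1)"
proof -
  define N where "N = m + n - 2 * d - 1"
  define a where "a = n - d"
  have N: "m + n - 2 * d = Suc N" "m + n = 2 * d + N + 1" "0 < N" and a: "n - d = a" "a \<le> N"
    and ma: "m - d = Suc N - a"
    using assms by (auto simp: N_def a_def)
  define A where "A = map_mat to_fract (G_mat d f g)"
  have A: "A \<in> carrier_mat (Suc N) (Suc N)"
    by (simp add: A_def G_mat_def Let_def m n N)
  have idx: "A $$ (i, j) =
      (if i < a then if j = N then 0
         else to_fract [:coeff_int f (int m + int i - int j):]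
       else if j = N then x_elem ^ (N - i)
         else to_fract [:coeff_int g (int n + int (i - a) - int j):])"
    if "i \<le> N" "j \<le> N" for i j
    using that a by (simp add: A_def G_mat_def Let_def m n N ma to_fract_monom)
  have "to_fract (G_poly d f g) = det A"
    by (simp add: A_def G_poly_def)
  also have "\<dots> = (-1) ^ (N + N) * det (mat N N (\<lambda>(i, j).
           if a \<le> i \<and> i < N then A $$ (i, j) - x_elem * A $$ (Suc i, j)
           else A $$ (if i < N then i else Suc i, j)))"
    by (rule det_geometric_last_col) (use A a in \<open>auto simp: idx\<close>)
  also have "mat N N (\<lambda>(i, j).
           if a \<le> i \<and> i < N then A $$ (i, j) - x_elem * A $$ (Suc i, j)
           else A $$ (if i < N then i else Suc i, j)) =
         mat N N (\<lambda>(i, j).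
           if i < Suc n - (d + 1) then coeff_int (in_y f) (int m + int i - int j)
           else coeff_int (tilde g) (int (Suc n) + int (i - (Suc n - (d + 1))) - int j))"
    using a by (intro eq_matI) (auto simp: idx coeff_int_tilde coeff_int_in_y Suc_diff_le algebra_simps)
  also have "det \<dots> = coeff (subresultant (d + 1) (in_y f) (tilde g)) (d + 1)"
    using assms N by (intro coeff_subresultant_index[symmetric]) (auto intro!: degree_tilde)
  finally show ?thesis
    by simp
qed

theorem lemma4p1:
  fixes f g :: "'a :: field poly" and m n d :: nat
  assumes "degree f = m" and "degree g = n" and "d < min m n"
  shows "to_fract (F_poly d f g) =
           (-1) ^ (m - d) * coeff (subresultant (d + 1) (tilde f) (in_y g)) (d + 1)
         \<and> to_fract (G_poly d f g) =
           coeff (subresultant (d + 1) (in_y f) (tilde g)) (d + 1)"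
  using assms by (simp add: to_fract_F_poly to_fract_G_poly)

end
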